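(* Let $\Gamma=\{1324,123\}$. Then for all $n\ge0$, $$U_{\Gamma,2n}(y)=\sum_{k=0}^n\frac{(2k+1)\binom{2n}{n-k}}{n+k+1}(-y)^{n+k}\quad\text{and}\quad U_{\Gamma,2n+1}(y)=\sum_{k=0}^n\frac{2(k+1)\binom{2n+1}{n-k}}{n+k+2}(-y)^{n+k+1}.$$
   Context: For $\sigma\in\mathfrak S_n$, $\mathrm{des}(\sigma)$ is the number of $i$ with $\sigma_i>\sigma_{i+1}$. For distinct integers $\alpha=\alpha_1\cdots\alpha_r$, $\mathrm{red}(\alpha)\in\mathfrak S_r$ replaces the $i$-th smallest entry by $i$. $\sigma$ has a $\Gamma$-match starting at position $i$ if there is $j\ge1$ with $\mathrm{red}(\sigma_i\cdots\sigma_{i+j})\in\Gamma$; $\mathcal{NM}_n(\Gamma)$ is the set of $\sigma\in\mathfrak S_n$ with no $\Gamma$-match. The polynomials $U_{\Gamma,n}(y)$ are defined by $\sum_{n\ge0}U_{\Gamma,n}(y)\frac{t^n}{n!}=\left(1+\sum_{n\ge1}\frac{t^n}{n!}\sum_{\sigma\in\mathcal{NM}_n(\Gamma)}y^{1+\mathrm{des}(\sigma)}\right)^{-1}$. *)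

theory Defs
  imports
    "HOL-Combinatorics.Multiset_Permutations"
    "HOL-Computational_Algebra.Polynomial"
    "HOL-Computational_Algebra.Formal_Power_Series"
begin

text \<open>A permutation of \<open>{1..n}\<close> is represented by its one-line word, an element of
  \<open>permutations_of_set {1..n}\<close>; list positions are counted from 0.\<close>

definition des :: "nat list \<Rightarrow> nat" where
  "des \<sigma> = card {i. Suc i < length \<sigma> \<and> \<sigma> ! i > \<sigma> ! Suc i}"

definition red :: "nat list \<Rightarrow> nat list" where
  "red \<alpha> = map (\<lambda>a. card {b \<in> set \<alpha>. b \<le> a}) \<alpha>"

definition match_at :: "nat list set \<Rightarrow> nat list \<Rightarrow> nat \<Rightarrow> bool" where
  "match_at \<Gamma> \<sigma> i \<longleftrightarrow>
     (\<exists>j\<ge>1. i + j < length \<sigma> \<and> red (map (\<lambda>l. \<sigma> ! l) [i..<Suc (i + j)]) \<in> \<Gamma>)"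

definition NM :: "nat list set \<Rightarrow> nat \<Rightarrow> nat list set" where
  "NM \<Gamma> n = {\<sigma> \<in> permutations_of_set {1..n}. \<not> (\<exists>i. match_at \<Gamma> \<sigma> i)}"

text \<open>The indeterminate \<open>y\<close>.\<close>

abbreviation Y :: "rat poly" where
  "Y \<equiv> [:0, 1:]"

definition NM_egf :: "nat list set \<Rightarrow> rat poly fps" where
  "NM_egf \<Gamma> =
     1 + Abs_fps (\<lambda>n. if n = 0 then 0 else smult (1 / fact n) (\<Sum>\<sigma>\<in>NM \<Gamma> n. Y ^ (1 + des \<sigma>)))"

text \<open>\<open>rat poly\<close> is not a field, so the reciprocal is the library's inverse of a power series
  over a ring, whose second argument is the inverse (here 1) of the constant coefficient.
  Lemmas \<open>U_egf\<close> and \<open>U_unique\<close> characterise \<open>U\<close> by its generating function.\<close>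

definition U :: "nat list set \<Rightarrow> nat \<Rightarrow> rat poly" where
  "U \<Gamma> n = smult (fact n) (fps_nth (fps_right_inverse (NM_egf \<Gamma>) 1) n)"

lemma NM_egf_nth_0: "fps_nth (NM_egf \<Gamma>) 0 = 1"
  by (simp add: NM_egf_def)

lemma U_egf: "NM_egf \<Gamma> * Abs_fps (\<lambda>n. smult (1 / fact n) (U \<Gamma> n)) = 1"
proof -
  have "Abs_fps (\<lambda>n. smult (1 / fact n) (U \<Gamma> n)) = fps_right_inverse (NM_egf \<Gamma>) 1"
    by (rule fps_ext) (simp add: U_def)
  then show ?thesis
    using fps_right_inverse[of "NM_egf \<Gamma>" 1] by (simp add: NM_egf_nth_0)
qed

lemma U_unique:
  assumes "NM_egf \<Gamma> * Abs_fps (\<lambda>n. smult (1 / fact n) (V n)) = 1"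
  shows "V = U \<Gamma>"
proof
  fix n
  define A where "A = Abs_fps (\<lambda>n. smult (1 / fact n) (V n))"
  define B where "B = Abs_fps (\<lambda>n. smult (1 / fact n) (U \<Gamma> n))"
  have A: "NM_egf \<Gamma> * A = 1" and B: "NM_egf \<Gamma> * B = 1"
    using assms U_egf[of \<Gamma>] by (simp_all only: A_def B_def)
  have "A = A * (NM_egf \<Gamma> * B)" by (simp only: B mult_1_right)
  also have "\<dots> = (NM_egf \<Gamma> * A) * B" by (simp only: mult_ac)
  also have "\<dots> = B" by (simp only: A mult_1_left)
  finally have "fps_nth A n = fps_nth B n" by (rule arg_cong)
  then have "smult (fact n) (smult (1 / fact n) (V n)) =
      smult (fact n) (smult (1 / fact n) (U \<Gamma> n))"
    by (simp only: A_def B_def fps_nth_Abs_fps)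
  then show "V n = U \<Gamma> n" by simp
qed

end

theory Submission
  imports Defs
begin

text \<open>
  Cut a word avoiding \<open>123\<close> at its descents into bricks, its maximal increasing runs, which have one
  or two letters. Call consecutive bricks linked if there is no descent between them or if they form
  a \<open>1324\<close>. Then \<open>NM\<close> counts the lists of bricks in which no two neighbours are linked,
  with weight \<open>y\<close> per brick. Its reciprocal counts the lists in which all neighbours are
  linked, with weight \<open>-y\<close> per brick: in the product, a fixed list of bricks is split into an
  unlinked prefix and a linked suffix, and the signs cancel. Linked lists
  are counted by deleting the largest letter repeatedly, which yields the ballot numbers.
\<close>

section \<open>Sums over subsets and over the cuts of a list\<close>

lemma sum_Pow_card:
  fixes f :: "nat \<Rightarrow> 'b::comm_semiring_1"
  assumes "finite S"
  shows "(\<Sum>T\<in>Pow S. f (card T)) = (\<Sum>k\<le>card S. of_nat (card S choose k) * f k)"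
proof -
  have "(\<Sum>T\<in>Pow S. f (card T)) = (\<Sum>k\<le>card S. \<Sum>T\<in>{T \<in> Pow S. card T = k}. f (card T))"
    by (rule sum.group[symmetric]) (use assms in \<open>auto intro: card_mono\<close>)
  also have "\<dots> = (\<Sum>k\<le>card S. of_nat (card S choose k) * f k)"
  proof (rule sum.cong[OF refl])
    fix k
    have "card {T \<in> Pow S. card T = k} = card S choose k"
      using n_subsets[OF assms, of k] by simp
    then show "(\<Sum>T\<in>{T \<in> Pow S. card T = k}. f (card T)) = of_nat (card S choose k) * f k"
      by simp
  qed
  finally show ?thesis .
qed

text \<open>The pair across the cut is unconstrained. Hence a nonempty list has either no admissible
  cut or exactly two, at consecutive positions and so with opposite signs.\<close>

lemma sum_alternating_splits:
  fixes R :: "'a \<Rightarrow> 'a \<Rightarrow> bool"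
  assumes "xs \<noteq> []"
  shows "(\<Sum>i\<le>length xs. of_bool (successively (\<lambda>a b. \<not> R a b) (take i xs)
           \<and> successively R (drop i xs)) * (- 1) ^ i) = (0 :: 'b::comm_ring_1)"
  using assms
proof (induction xs rule: induct_list012)
  case (3 x y zs)
  define f where "f i = (of_bool (successively (\<lambda>a b. \<not> R a b) (take i (y # zs))
      \<and> successively R (drop i (y # zs))) * (- 1) ^ i :: 'b)" for i
  define g where "g i = (of_bool (successively (\<lambda>a b. \<not> R a b) (take i (x # y # zs))
      \<and> successively R (drop i (x # y # zs))) * (- 1) ^ i :: 'b)" for i
  have f: "f 0 + (\<Sum>i\<le>length zs. f (Suc i)) = 0"
    using 3(2) by (simp add: f_def[symmetric] sum.atMost_Suc_shift del: sum.atMost_Suc)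
  \<comment> \<open>A cut at 2 or later needs \<open>\<not> R x y\<close>, a cut at 0 needs
    \<open>R x y\<close>, and a cut at 1 separates the pair.\<close>
  have g2: "g (Suc (Suc i)) = - of_bool (\<not> R x y) * f (Suc i)" for i
    by (simp add: f_def g_def)
  have "g 0 = of_bool (R x y) * f 0" "g (Suc 0) = - f 0"
    by (simp_all add: f_def g_def)
  moreover have "(\<Sum>i\<le>length (x # y # zs). g i) =
      g 0 + (g (Suc 0) + (\<Sum>i\<le>length zs. g (Suc (Suc i))))"
    by (simp add: sum.atMost_Suc_shift del: sum.atMost_Suc)
  moreover have "(\<Sum>i\<le>length zs. g (Suc (Suc i))) = - of_bool (\<not> R x y) * (- f 0)"
    using f by (simp add: g2 sum_distrib_left[symmetric] sum_negf add_eq_0_iff)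
  ultimately have "(\<Sum>i\<le>length (x # y # zs). g i) = 0"
    by (cases "R x y") simp_all
  then show ?case by (simp only: g_def)
qed simp_all

section \<open>Bricks, chains and their cancellation\<close>

definition brick :: "nat list \<Rightarrow> bool" where
  "brick b \<longleftrightarrow> (\<exists>x. b = [x]) \<or> (\<exists>x y. b = [x, y] \<and> x < y)"

text \<open>A 1324 ascends at its first and third step, so in a word without 123 it fills exactly
  two consecutive two-letter bricks.\<close>

definition linked :: "nat list \<Rightarrow> nat list \<Rightarrow> bool" where
  "linked b c \<longleftrightarrow> last b < hd c \<or>
     length b = 2 \<and> length c = 2 \<and> hd b < hd c \<and> hd c < last b \<and> last b < last c"

definition brick_lists :: "nat set \<Rightarrow> nat list list set" where
  "brick_lists S =
     {bs. (\<forall>b\<in>set bs. brick b) \<and> distinct (concat bs) \<and> set (concat bs) = S}"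

definition linked_chains :: "nat set \<Rightarrow> nat list list set" where
  "linked_chains S = {bs \<in> brick_lists S. successively linked bs}"

definition unlinked_chains :: "nat set \<Rightarrow> nat list list set" where
  "unlinked_chains S = {bs \<in> brick_lists S. successively (\<lambda>b c. \<not> linked b c) bs}"

definition unlinked_poly :: "nat set \<Rightarrow> rat poly" where
  "unlinked_poly S = (\<Sum>bs\<in>unlinked_chains S. Y ^ length bs)"

definition linked_poly :: "nat set \<Rightarrow> rat poly" where
  "linked_poly S = (\<Sum>bs\<in>linked_chains S. (- Y) ^ length bs)"

lemma length_le_length_concat:
  "(\<forall>b\<in>set bs. b \<noteq> []) \<Longrightarrow> length bs \<le> length (concat bs)"
  by (induction bs) (auto simp: Suc_le_eq neq_Nil_conv)

lemma finite_brick_lists: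
  assumes "finite S"
  shows "finite (brick_lists S)"
proof (rule finite_subset)
  show "brick_lists S \<subseteq>
      {bs. set bs \<subseteq> {b. set b \<subseteq> S \<and> length b \<le> 2} \<and> length bs \<le> card S}"
  proof
    fix bs assume bs: "bs \<in> brick_lists S"
    then have "length bs \<le> length (concat bs)"
      by (intro length_le_length_concat) (auto simp: brick_lists_def brick_def)
    also have "\<dots> = card S"
      using bs distinct_card[of "concat bs"] by (auto simp: brick_lists_def)
    finally show "bs \<in> {bs. set bs \<subseteq> {b. set b \<subseteq> S \<and> length b \<le> 2} \<and> length bs \<le> card S}"
      using bs by (fastforce simp: brick_lists_def brick_def)
  qed
  show "finite {bs. set bs \<subseteq> {b. set b \<subseteq> S \<and> length b \<le> 2} \<and> length bs \<le> card S}"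
    using assms by (intro finite_lists_length_le finite_lists_length_le[of S 2, simplified])
qed

lemma finite_chains:
  assumes "finite S"
  shows "finite (linked_chains S)" "finite (unlinked_chains S)"
  using finite_brick_lists[OF assms] by (auto simp: linked_chains_def unlinked_chains_def)

lemma brick_lists_empty: "brick_lists {} = {[]}"
proof -
  have "bs = []" if "bs \<in> brick_lists {}" for bs
    using that by (cases bs) (auto simp: brick_lists_def brick_def)
  moreover have "[] \<in> brick_lists {}" by (simp add: brick_lists_def)
  ultimately show ?thesis by blast
qed

lemma unlinked_chains_empty: "unlinked_chains {} = {[]}"
  by (auto simp: unlinked_chains_def brick_lists_empty)

lemma set_concat_brick_lists: "bs \<in> brick_lists S \<Longrightarrow> set (concat bs) = S"
  by (simp add: brick_lists_def)

lemma brick_lists_append: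
  "as @ bs \<in> brick_lists S \<longleftrightarrow>
     set (concat as) \<subseteq> S \<and> as \<in> brick_lists (set (concat as)) \<and>
     bs \<in> brick_lists (S - set (concat as))"
  by (auto simp: brick_lists_def)

text \<open>The convolution over subsets mirrors the product of exponential generating functions. A
  pair of chains on \<open>T\<close> and \<open>S - T\<close> is a brick list of \<open>S\<close>
  with an admissible cut, and \<open>sum_alternating_splits\<close> cancels the cuts of each fixed
  list. Only the empty list, excluded by \<open>S \<noteq> {}\<close>, would survive.\<close>

lemma sum_unlinked_linked_poly:
  assumes "finite S" "S \<noteq> {}"
  shows "(\<Sum>T\<in>Pow S. unlinked_poly T * linked_poly (S - T)) = 0"
proof -
  have fin: "finite T" if "T \<in> Pow S" for T
    using that assms(1) finite_subset by auto
  define ok where "ok bs i \<longleftrightarrow>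
    successively (\<lambda>b c. \<not> linked b c) (take i bs) \<and> successively linked (drop i bs)" for bs i
  define w where "w bs i = Y ^ i * (- Y) ^ (length bs - i)" for bs :: "nat list list" and i
  let ?P = "SIGMA T:Pow S. unlinked_chains T \<times> linked_chains (S - T)"
  let ?Q = "SIGMA bs:brick_lists S. {..length bs}"
  have "finite ?Q" using finite_brick_lists[OF assms(1)] by simp
  have "(\<Sum>T\<in>Pow S. unlinked_poly T * linked_poly (S - T)) =
      (\<Sum>T\<in>Pow S. \<Sum>(as, bs)\<in>unlinked_chains T \<times> linked_chains (S - T).
         Y ^ length as * (- Y) ^ length bs)"
    by (simp add: unlinked_poly_def linked_poly_def sum_product sum.cartesian_product)
  also have "\<dots> = (\<Sum>(T, as, bs)\<in>?P. Y ^ length as * (- Y) ^ length bs)"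
    using assms(1) fin finite_chains by (subst sum.Sigma) auto
  \<comment> \<open>Two chains become their concatenation together with the cut position;
    \<open>T\<close> is recovered as the set of letters before the cut.\<close>
  also have "\<dots> = (\<Sum>(bs, i)\<in>{p \<in> ?Q. case p of (bs, i) \<Rightarrow> ok bs i}. w bs i)"
  proof (rule sum.reindex_bij_witness[where
        j = "\<lambda>(T, as, bs). (as @ bs, length as)" and
        i = "\<lambda>(bs, i). (set (concat (take i bs)), take i bs, drop i bs)"])
    fix p assume "p \<in> ?P"
    then obtain T as bs where p: "p = (T, as, bs)" "T \<subseteq> S"
      "as \<in> brick_lists T" "successively (\<lambda>b c. \<not> linked b c) as"
      "bs \<in> brick_lists (S - T)" "successively linked bs"
      by (auto simp: unlinked_chains_def linked_chains_def)
    have T: "set (concat as) = T" using p(3) by (rule set_concat_brick_lists)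
    have "as @ bs \<in> brick_lists S" using p by (simp only: brick_lists_append T)
    then show "(case p of (T, as, bs) \<Rightarrow> (as @ bs, length as)) \<in>
        {p \<in> ?Q. case p of (bs, i) \<Rightarrow> ok bs i}"
      using p by (simp add: ok_def)
    show "(case case p of (T, as, bs) \<Rightarrow> (as @ bs, length as) of
        (bs, i) \<Rightarrow> (set (concat (take i bs)), take i bs, drop i bs)) = p"
      using T by (simp add: p)
    show "(case case p of (T, as, bs) \<Rightarrow> (as @ bs, length as) of (bs, i) \<Rightarrow> w bs i) =
        (case p of (T, as, bs) \<Rightarrow> Y ^ length as * (- Y) ^ length bs)"
      by (simp add: p w_def)
  next
    fix q assume "q \<in> {p \<in> ?Q. case p of (bs, i) \<Rightarrow> ok bs i}"
    then obtain bs i where q: "q = (bs, i)" "bs \<in> brick_lists S" "i \<le> length bs" "ok bs i"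
      by auto
    show "(case case q of (bs, i) \<Rightarrow> (set (concat (take i bs)), take i bs, drop i bs) of
        (T, as, bs) \<Rightarrow> (as @ bs, length as)) = q"
      using q(3) by (simp add: q(1))
    show "(case q of (bs, i) \<Rightarrow> (set (concat (take i bs)), take i bs, drop i bs)) \<in> ?P"
      using q(2,4) brick_lists_append[of "take i bs" "drop i bs" S]
      by (simp add: q(1) unlinked_chains_def linked_chains_def ok_def)
  qed
  also have "\<dots> = (\<Sum>(bs, i)\<in>?Q. of_bool (ok bs i) * w bs i)"
    unfolding sum.inter_filter[OF \<open>finite ?Q\<close>]
    by (rule sum.cong) (auto simp del: mem_Sigma_iff)
  also have "\<dots> = (\<Sum>bs\<in>brick_lists S. \<Sum>i\<le>length bs. of_bool (ok bs i) * w bs i)"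
    using finite_brick_lists[OF assms(1)] by (subst sum.Sigma) simp_all
  also have "\<dots> = (\<Sum>bs\<in>brick_lists S. 0)"
  proof (rule sum.cong[OF refl])
    fix bs assume "bs \<in> brick_lists S"
    then have "bs \<noteq> []" using assms(2) by (auto simp: brick_lists_def)
    \<comment> \<open>The weight differs from \<open>(- Y) ^ length bs\<close> only by the sign
      \<open>(- 1) ^ i\<close>, so an alternating sum over the cuts remains.\<close>
    have "(\<Sum>i\<le>length bs. of_bool (ok bs i) * w bs i) =
        (\<Sum>i\<le>length bs. (- Y) ^ length bs * (of_bool (ok bs i) * (- 1) ^ i))"
    proof (rule sum.cong[OF refl])
      fix i assume "i \<in> {..length bs}"
      then have "(- Y) ^ length bs = (- Y) ^ i * (- Y) ^ (length bs - i)"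
        by (simp flip: power_add)
      moreover have "Y ^ i = (- Y) ^ i * (- 1) ^ i"
        by (simp flip: power_mult_distrib)
      ultimately show "of_bool (ok bs i) * w bs i =
          (- Y) ^ length bs * (of_bool (ok bs i) * (- 1) ^ i)"
        by (simp only: w_def mult_ac)
    qed
    also have "\<dots> = (- Y) ^ length bs * (\<Sum>i\<le>length bs. of_bool (ok bs i) * (- 1) ^ i)"
      by (simp only: sum_distrib_left)
    also have "\<dots> = 0"
      unfolding ok_def sum_alternating_splits[OF \<open>bs \<noteq> []\<close>] by (rule mult_zero_right)
    finally show "(\<Sum>i\<le>length bs. of_bool (ok bs i) * w bs i) = 0" .
  qed
  finally show ?thesis by simp
qed

section \<open>Linked chains and their largest letter\<close>

text \<open>Deleting the largest letters of a linked chain opens its last two-letter bricks: \<open>as\<close>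
  lists the \<open>h\<close> first letters whose partners have been deleted.\<close>

definition open_chains :: "nat \<Rightarrow> nat set \<Rightarrow> (nat list list \<times> nat list) set" where
  "open_chains h S = {(bs, as). length as = h \<and> sorted_wrt (<) as \<and> (\<forall>b\<in>set bs. brick b) \<and>
     successively linked bs \<and> distinct (concat bs @ as) \<and> set (concat bs @ as) = S \<and>
     (bs \<noteq> [] \<and> as \<noteq> [] \<longrightarrow> hd (last bs) < hd as)}"

definition open_poly :: "nat \<Rightarrow> nat set \<Rightarrow> rat poly" where
  "open_poly h S = (\<Sum>(bs, as)\<in>open_chains h S. (- Y) ^ (length bs + length as))"

lemma linked_imp_less:
  assumes "brick b" "brick c" "linked b c"
  shows "hd b < hd c" "last b < last c"
  using assms by (auto simp: brick_def linked_def)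

text \<open>Last letters increase along a linked chain and each is the maximum of its brick. This
  places the largest letter of the chain at the end of its last brick.\<close>

lemma linked_chain_le_last:
  assumes "\<forall>b\<in>set bs. brick b" "successively linked bs" "x \<in> set (concat bs)"
  shows "x \<le> last (last bs)"
  using assms
proof (induction bs rule: rev_induct)
  case (snoc b bs)
  show ?case
  proof (cases "x \<in> set b")
    case True
    then show ?thesis using snoc.prems(1) by (auto simp: brick_def)
  next
    case False
    then have x: "x \<in> set (concat bs)" and "bs \<noteq> []" using snoc.prems(3) by auto
    then have "linked (last bs) b" using snoc.prems(2) by (simp add: successively_append_iff)
    then have "last (last bs) < last b"
      using linked_imp_less(2)[of "last bs" b] snoc.prems(1) \<open>bs \<noteq> []\<close> by simp
    then show ?thesis
      using snoc.IH snoc.prems x by (auto simp: successively_append_iff)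
  qed
qed simp

text \<open>Two-letter bricks with distinct letters are linked exactly when both their first letters
  and their last letters increase. Open letters are therefore closed in the order of the list: the
  largest letter \<open>M\<close> either closes the first of them or is itself the last of them. It
  is a one-letter brick only if nothing is open, since an open letter after it would have to exceed
  it.\<close>

lemma open_chains_insert_Max:
  assumes "\<And>x. x \<in> S \<Longrightarrow> x < M"
  shows "open_chains h (insert M S) =
     (if h = 0 then (\<lambda>(bs, as). (bs @ [[M]], as)) ` open_chains 0 S
      else (\<lambda>(bs, as). (bs, as @ [M])) ` open_chains (h - 1) S) \<union>
     (\<lambda>(bs, as). (bs @ [[hd as, M]], tl as)) ` open_chains (Suc h) S"
    (is "?L = ?A \<union> ?B")
proof (intro equalityI subsetI)
  fix p assume "p \<in> ?L"
  then obtain bs as where p: "p = (bs, as)" and h: "length as = h"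
    and sorted: "sorted_wrt (<) as" and bricks: "\<forall>b\<in>set bs. brick b"
    and chain: "successively linked bs" and dist: "distinct (concat bs @ as)"
    and set: "set (concat bs @ as) = insert M S"
    and gap: "bs \<noteq> [] \<Longrightarrow> as \<noteq> [] \<Longrightarrow> hd (last bs) < hd as"
    unfolding open_chains_def by blast
  have le_M: "x \<le> M" if "x \<in> set (concat bs @ as)" for x
  proof -
    have "x = M \<or> x \<in> S" using that set by blast
    then show ?thesis using assms by (auto intro: less_imp_le)
  qed
  have "M \<notin> S" using assms by blast
  show "p \<in> ?A \<union> ?B"
  proof (cases "M \<in> set as")
    case True
    then obtain as' a where as: "as = as' @ [a]" by (cases as rule: rev_cases) auto
    have "a = M" using True sorted le_M[of a] by (auto simp: as sorted_wrt_append)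
    have "insert M (set (concat bs @ as')) = insert M S" "M \<notin> set (concat bs @ as')"
      using set dist by (auto simp: as \<open>a = M\<close>)
    then have "set (concat bs @ as') = S"
      using \<open>M \<notin> S\<close> insert_ident by metis
    then have "(bs, as') \<in> open_chains (h - 1) S"
      using h sorted bricks chain dist gap
      by (auto simp: as \<open>a = M\<close> open_chains_def sorted_wrt_append)
    then have "p \<in> ?A" using h by (force simp: p as \<open>a = M\<close>)
    then show ?thesis by blast
  next
    case False
    then have M: "M \<in> set (concat bs)" using set by auto
    then obtain bs' b where bs: "bs = bs' @ [b]" by (cases bs rule: rev_cases) auto
    have "brick b" using bricks bs by simp
    have "last b = M"
      using linked_chain_le_last[OF bricks chain M] le_M[of "last b"] \<open>brick b\<close>
      by (auto simp: bs brick_def)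
    then consider "b = [M]" | c where "b = [c, M]" "c < M"
      using \<open>brick b\<close> by (auto simp: brick_def)
    then show ?thesis
    proof cases
      case 1
      have "as = []"
        using gap le_M[of "hd as"] by (cases as) (auto simp: bs 1)
      have "insert M (set (concat bs')) = insert M S" "M \<notin> set (concat bs')"
        using set dist by (auto simp: bs 1 \<open>as = []\<close>)
      then have "set (concat bs') = S"
        using \<open>M \<notin> S\<close> insert_ident by metis
      then have "(bs', []) \<in> open_chains 0 S"
        using bricks chain dist
        by (auto simp: bs 1 open_chains_def successively_append_iff)
      then have "p \<in> ?A" using h \<open>as = []\<close> by (force simp: p bs 1)
      then show ?thesis by blast
    next
      case 2
      \<comment> \<open>Reopening \<open>[c, M]\<close> puts \<open>c\<close> in front of the open
        letters, so \<open>c\<close> must exceed the first letter of the previous brick and lie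
        below all of \<open>as\<close>.\<close>
      have "hd (last bs') < c" if "bs' \<noteq> []"
        using that chain bricks linked_imp_less(1)[of "last bs'" b]
        by (simp add: bs 2 successively_append_iff)
      moreover have "\<forall>a\<in>set as. c < a"
        using gap sorted by (cases as) (auto simp: bs 2)
      moreover have "set (concat bs' @ c # as) = S"
      proof -
        have "insert M (set (concat bs' @ c # as)) = insert M S" "M \<notin> set (concat bs' @ c # as)"
          using set dist \<open>c < M\<close> by (auto simp: bs 2(1))
        then show ?thesis using \<open>M \<notin> S\<close> insert_ident by metis
      qed
      ultimately have "(bs', c # as) \<in> open_chains (Suc h) S"
        using h sorted bricks chain dist
        by (auto simp: bs 2 open_chains_def successively_append_iff)
      then have "p \<in> ?B" by (force simp: p bs 2)
      then show ?thesis by blast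
    qed
  qed
next
  have "M \<notin> S" using assms by blast
  fix p assume "p \<in> ?A \<union> ?B"
  then consider
      (single) bs where "h = 0" "p = (bs @ [[M]], [])" "(bs, []) \<in> open_chains 0 S"
    | (open_last) bs as where "h \<noteq> 0" "p = (bs, as @ [M])" "(bs, as) \<in> open_chains (h - 1) S"
    | (close_first) bs c as where "p = (bs @ [[c, M]], as)" "(bs, c # as) \<in> open_chains (Suc h) S"
    by (auto simp: open_chains_def length_Suc_conv split: if_splits)
  then show "p \<in> ?L"
  proof cases
    case single
    then have *: "\<forall>b\<in>set bs. brick b" "successively linked bs" "distinct (concat bs)"
      "set (concat bs) = S" by (auto simp: open_chains_def)
    have "linked (last bs) [M]" if "bs \<noteq> []"
    proof -
      have "last bs \<in> set bs" "brick (last bs)" using that * by auto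
      then have "last (last bs) \<in> set (concat bs)" by (force simp: brick_def)
      then show ?thesis using * assms by (auto simp: linked_def)
    qed
    then show ?thesis using single * \<open>M \<notin> S\<close>
      by (auto simp: open_chains_def successively_append_iff brick_def)
  next
    case open_last
    then have *: "\<forall>b\<in>set bs. brick b" "successively linked bs" "distinct (concat bs @ as)"
      "set (concat bs @ as) = S" "length as = h - 1" "sorted_wrt (<) as"
      "bs \<noteq> [] \<Longrightarrow> as \<noteq> [] \<Longrightarrow> hd (last bs) < hd as" by (auto simp: open_chains_def)
    have "hd (last bs) < M" if "bs \<noteq> []"
    proof -
      have "last bs \<in> set bs" "brick (last bs)" using that * by auto
      then have "hd (last bs) \<in> set (concat bs)" by (force simp: brick_def)
      then show ?thesis using * assms by auto
    qed
    then show ?thesis using open_last * \<open>M \<notin> S\<close> assms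
      by (auto simp: open_chains_def sorted_wrt_append hd_append)
  next
    case close_first
    then have *: "\<forall>b\<in>set bs. brick b" "successively linked bs" "distinct (concat bs @ c # as)"
      "set (concat bs @ c # as) = S" "length as = h" "sorted_wrt (<) (c # as)"
      "bs \<noteq> [] \<Longrightarrow> hd (last bs) < c" by (auto simp: open_chains_def)
    \<comment> \<open>If the last letter of the chain is below \<open>c\<close>, the bricks are
      linked at once. Otherwise the previous brick has two letters, because its first letter is
      below \<open>c\<close>, and it forms a 1324 with \<open>[c, M]\<close>.\<close>
    have "linked (last bs) [c, M]" if "bs \<noteq> []"
    proof -
      have "last bs \<in> set bs" and b: "brick (last bs)" using that * by auto
      then have "last (last bs) \<in> set (concat bs)" by (force simp: brick_def)
      then have "last (last bs) < M" "last (last bs) \<noteq> c" using * assms by auto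
      then show ?thesis using b *(7)[OF that] by (auto simp: linked_def brick_def)
    qed
    moreover have "c < M" using * assms by auto
    ultimately show ?thesis using close_first * \<open>M \<notin> S\<close>
      by (auto simp: open_chains_def successively_append_iff brick_def)
  qed
qed

lemma finite_open_chains:
  assumes "finite S"
  shows "finite (open_chains h S)"
proof (rule finite_subset)
  show "open_chains h S \<subseteq> (\<Union>T\<in>Pow S. brick_lists T) \<times> {as. set as \<subseteq> S \<and> length as = h}"
    by (auto simp: open_chains_def brick_lists_def)
  show "finite ((\<Union>T\<in>Pow S. brick_lists T) \<times> {as. set as \<subseteq> S \<and> length as = h})"
    using assms finite_brick_lists
    by (intro finite_cartesian_product finite_lists_length_eq) (auto dest: finite_subset)
qed

text \<open>A new one-letter brick or open letter contributes \<open>- Y\<close>, while closing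
  turns an open letter into a brick and keeps the weight.\<close>

lemma open_poly_insert_Max:
  assumes "finite S" "\<And>x. x \<in> S \<Longrightarrow> x < M"
  shows "open_poly h (insert M S) = - Y * open_poly (h - 1) S + open_poly (Suc h) S"
proof -
  let ?w = "\<lambda>(bs, as). (- Y) ^ (length bs + length as)"
  \<comment> \<open>For \<open>h = 0\<close> truncated subtraction gives \<open>h - 1 = 0\<close>,
    so both branches start from \<open>open_chains (h - 1) S\<close>.\<close>
  let ?f = "if h = 0 then (\<lambda>(bs, as). (bs @ [[M]], as)) else (\<lambda>(bs, as). (bs, as @ [M]))"
  let ?g = "\<lambda>(bs, as). (bs @ [[hd as, M]], tl as)"
  have "M \<notin> S" using assms by blast
  have "open_chains h (insert M S) = ?f ` open_chains (h - 1) S \<union> ?g ` open_chains (Suc h) S"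
    using open_chains_insert_Max[OF assms(2), of S h] by simp
  moreover have "?f ` open_chains (h - 1) S \<inter> ?g ` open_chains (Suc h) S = {}"
    using \<open>M \<notin> S\<close> by (auto simp: open_chains_def length_Suc_conv)
  moreover have "inj_on ?f (open_chains (h - 1) S)" by (auto simp: inj_on_def)
  moreover have "inj_on ?g (open_chains (Suc h) S)"
  proof (rule inj_onI)
    fix p q assume mem: "p \<in> open_chains (Suc h) S" "q \<in> open_chains (Suc h) S"
      and eq: "?g p = ?g q"
    from mem(1) obtain bs a as where "p = (bs, a # as)"
      by (auto simp: open_chains_def length_Suc_conv)
    moreover from mem(2) obtain bs' a' as' where "q = (bs', a' # as')"
      by (auto simp: open_chains_def length_Suc_conv)
    ultimately show "p = q" using eq by simp
  qed
  ultimately have "open_poly h (insert M S) =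
      (\<Sum>p\<in>open_chains (h - 1) S. ?w (?f p)) + (\<Sum>p\<in>open_chains (Suc h) S. ?w (?g p))"
    by (simp only: open_poly_def)
      (subst sum.union_disjoint, simp_all add: finite_open_chains assms(1) sum.reindex)
  also have "(\<Sum>p\<in>open_chains (h - 1) S. ?w (?f p)) = - Y * open_poly (h - 1) S"
    unfolding open_poly_def sum_distrib_left by (rule sum.cong) auto
  also have "(\<Sum>p\<in>open_chains (Suc h) S. ?w (?g p)) = open_poly (Suc h) S"
    unfolding open_poly_def
    by (rule sum.cong) (auto simp: open_chains_def length_Suc_conv)
  finally show ?thesis .
qed

section \<open>Ballot numbers\<close>

text \<open>\<open>ballot m u\<close> counts the words with \<open>m - u\<close> up steps and \<open>u\<close> down steps that never go below
  zero, provided that \<open>2 * u \<le> m + 1\<close>.\<close>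

definition ballot :: "nat \<Rightarrow> nat \<Rightarrow> rat" where
  "ballot m u = of_nat (m choose u) - (if u = 0 then 0 else of_nat (m choose (u - 1)))"

text \<open>Here \<open>u\<close> stands for the number of two-letter bricks: together with
  \<open>h\<close> open letters they use \<open>2 * u + h\<close> of the \<open>m\<close> letters,
  and \<open>m - u\<close> bricks and open letters carry the weight.\<close>

definition ballot_poly :: "nat \<Rightarrow> nat \<Rightarrow> rat poly" where
  "ballot_poly h m = (\<Sum>u\<le>m. if 2 * u + h \<le> m then smult (ballot m u) ((- Y) ^ (m - u)) else 0)"

lemma ballot_0: "ballot m 0 = 1"
  by (simp add: ballot_def)

lemma ballot_Suc_Suc: "ballot (Suc m) (Suc u) = ballot m (Suc u) + ballot m u"
  by (cases u) (simp_all add: ballot_def)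

lemma ballot_middle: "ballot (Suc (2 * u)) (Suc u) = 0"
proof -
  have "Suc (2 * u) choose Suc u = Suc (2 * u) choose u"
    using binomial_symmetric[of u "Suc (2 * u)"] by simp
  then show ?thesis by (simp add: ballot_def)
qed

text \<open>This is the recurrence of \<open>open_poly_insert_Max\<close>, obtained here from
  Pascal's rule.\<close>

lemma ballot_poly_Suc:
  "ballot_poly h (Suc m) = - Y * ballot_poly (h - 1) m + ballot_poly (Suc h) m"
proof -
  define t where "t u = smult (ballot m u) ((- Y) ^ (Suc m - u))" for u
  have *: "- Y * ballot_poly (h - 1) m =
      (\<Sum>u\<le>Suc m. if 2 * u + h \<le> Suc m then t u else 0)"
  proof -
    have "- Y * ballot_poly (h - 1) m = (\<Sum>u\<le>m. if 2 * u + h \<le> Suc m then t u else 0)"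
      unfolding ballot_poly_def sum_distrib_left
    proof (rule sum.cong[OF refl])
      fix u assume "u \<in> {..m}"
      then have "- Y * smult (ballot m u) ((- Y) ^ (m - u)) = t u"
        by (simp add: t_def Suc_diff_le)
      \<comment> \<open>The two ranges of \<open>u\<close> differ only for \<open>h = 0\<close> and
        \<open>2 * u = Suc m\<close>, where the ballot number vanishes.\<close>
      moreover have "t u = 0" if mid: "2 * u = Suc m"
      proof -
        obtain v where "u = Suc v" using mid by (cases u) simp_all
        then show ?thesis using mid ballot_middle[of v] by (simp add: t_def)
      qed
      ultimately show "- Y * (if 2 * u + (h - 1) \<le> m then smult (ballot m u) ((- Y) ^ (m - u)) else 0) =
          (if 2 * u + h \<le> Suc m then t u else 0)"
        by (cases h) (auto simp: le_Suc_eq)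
    qed
    then show ?thesis by simp
  qed
  \<comment> \<open>After splitting off \<open>u = 0\<close> and shifting the index, Pascal's rule
    separates \<open>t (Suc u)\<close> from the terms of \<open>ballot_poly (Suc h) m\<close>; the
    condition on \<open>u\<close> is the same as \<open>2 * u + Suc h \<le> m\<close>.\<close>
  have "ballot_poly h (Suc m) = (if h \<le> Suc m then t 0 else 0) +
      (\<Sum>u\<le>m. if 2 * Suc u + h \<le> Suc m then smult (ballot (Suc m) (Suc u)) ((- Y) ^ (m - u)) else 0)"
    unfolding ballot_poly_def
    by (subst sum.atMost_Suc_shift) (auto simp: t_def ballot_0 intro!: sum.cong)
  also have "(\<Sum>u\<le>m. if 2 * Suc u + h \<le> Suc m then smult (ballot (Suc m) (Suc u)) ((- Y) ^ (m - u)) else 0) =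
      (\<Sum>u\<le>m. if 2 * Suc u + h \<le> Suc m then t (Suc u) else 0) + ballot_poly (Suc h) m"
    unfolding ballot_poly_def sum.distrib[symmetric]
    by (rule sum.cong) (auto simp: t_def ballot_Suc_Suc smult_add_left)
  finally show ?thesis
    unfolding * by (subst sum.atMost_Suc_shift) (simp add: add_ac)
qed

lemma open_poly_eq_ballot_poly:
  assumes "finite S"
  shows "open_poly h S = ballot_poly h (card S)"
  using assms
proof (induction S arbitrary: h rule: finite_linorder_max_induct)
  case empty
  have "open_chains h {} = (if h = 0 then {([], [])} else {})"
  proof -
    have "bs = []" if "\<forall>b\<in>set bs. brick b" "set (concat bs @ as) = {}" for bs and as :: "nat list"
      using that by (cases bs) (auto simp: brick_def)
    then show ?thesis by (auto simp: open_chains_def)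
  qed
  then show ?case by (simp add: open_poly_def ballot_poly_def ballot_0)
next
  case (insert M S)
  then have "M \<notin> S" by blast
  then show ?case
    using insert open_poly_insert_Max[of S M h] by (simp add: ballot_poly_Suc)
qed

lemma linked_poly_eq_ballot_poly:
  assumes "finite S"
  shows "linked_poly S = ballot_poly 0 (card S)"
proof -
  have "open_chains 0 S = (\<lambda>bs. (bs, [])) ` linked_chains S"
    by (auto simp: open_chains_def linked_chains_def brick_lists_def)
  then have "open_poly 0 S = linked_poly S"
    by (simp add: open_poly_def linked_poly_def sum.reindex inj_on_def)
  then show ?thesis using open_poly_eq_ballot_poly[OF assms] by simp
qed

section \<open>Recursion for the unlinked polynomials\<close>

text \<open>The cancellation is solved for the term \<open>T = S\<close>, whose linked factor is 1.
  The assumption on proper subsets is the induction hypothesis of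
  \<open>unlinked_poly_card\<close>.\<close>

lemma unlinked_poly_card_Suc:
  assumes "finite S" "card S = Suc n"
    and card: "\<And>T. T \<subset> S \<Longrightarrow> unlinked_poly T = unlinked_poly {1..card T}"
  shows "unlinked_poly S =
    - (\<Sum>k\<le>n. of_nat (Suc n choose k) * (unlinked_poly {1..k} * ballot_poly 0 (Suc n - k)))"
proof -
  \<comment> \<open>The case \<open>k = Suc n\<close> is set apart because
    \<open>unlinked_poly S\<close> is not yet known to depend only on the size of
    \<open>S\<close>.\<close>
  define f where "f k = (if k = Suc n then unlinked_poly S else unlinked_poly {1..k})
      * ballot_poly 0 (Suc n - k)" for k
  have "0 = (\<Sum>T\<in>Pow S. unlinked_poly T * linked_poly (S - T))"
    using assms by (subst sum_unlinked_linked_poly) auto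
  also have "\<dots> = (\<Sum>T\<in>Pow S. f (card T))"
  proof (rule sum.cong[OF refl])
    fix T assume "T \<in> Pow S"
    then have "T \<subseteq> S" by simp
    then have "linked_poly (S - T) = ballot_poly 0 (Suc n - card T)"
      using assms linked_poly_eq_ballot_poly[of "S - T"] finite_subset[of T S]
      by (simp add: card_Diff_subset)
    moreover have "unlinked_poly T =
        (if card T = Suc n then unlinked_poly S else unlinked_poly {1..card T})"
      using \<open>T \<subseteq> S\<close> assms card_subset_eq[of S T] by auto
    ultimately show "unlinked_poly T * linked_poly (S - T) = f (card T)"
      by (simp only: f_def)
  qed
  also have "\<dots> = (\<Sum>k\<le>Suc n. of_nat (Suc n choose k) * f k)"
    using sum_Pow_card[OF assms(1), of f] assms(2) by simp
  also have "\<dots> = (\<Sum>k\<le>n. of_nat (Suc n choose k) * f k) + f (Suc n)"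
    by simp
  also have "f (Suc n) = unlinked_poly S"
    by (simp add: f_def ballot_poly_def ballot_0)
  also have "(\<Sum>k\<le>n. of_nat (Suc n choose k) * f k) =
      (\<Sum>k\<le>n. of_nat (Suc n choose k) * (unlinked_poly {1..k} * ballot_poly 0 (Suc n - k)))"
    by (rule sum.cong) (auto simp: f_def)
  finally show ?thesis by (simp add: eq_neg_iff_add_eq_0 add.commute)
qed

text \<open>By strong induction, \<open>S\<close> and \<open>{1..card S}\<close> satisfy the same
  recursion, whose right side involves only the size.\<close>

lemma unlinked_poly_card:
  assumes "finite S"
  shows "unlinked_poly S = unlinked_poly {1..card S}"
  using assms
proof (induction "card S" arbitrary: S rule: less_induct)
  case less
  show ?case
  proof (cases "card S")
    case 0
    then show ?thesis using less.prems by simp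
  next
    case (Suc n)
    have "unlinked_poly T = unlinked_poly {1..card T}" if "T \<subset> S'" "finite S'" "card S' = Suc n" for T S'
    proof (rule less.hyps)
      show "card T < card S" using that psubset_card_mono[of S' T] Suc by simp
      show "finite T" using that finite_subset[of T S'] by blast
    qed
    then show ?thesis
      using unlinked_poly_card_Suc[of S n] unlinked_poly_card_Suc[of "{1..Suc n}" n] less.prems Suc
      by simp
  qed
qed

section \<open>Avoiding words as unlinked chains\<close>

text \<open>A recursive test for the absence of 123 and 1324, tied to \<open>match_at\<close> by
  \<open>avoids_iff_no_match\<close>.\<close>

fun avoids :: "nat list \<Rightarrow> bool" where
  "avoids (a # b # c # d # xs) \<longleftrightarrow>
     \<not> (a < b \<and> b < c) \<and> \<not> (a < c \<and> c < b \<and> b < d) \<and> avoids (b # c # d # xs)"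
| "avoids [a, b, c] \<longleftrightarrow> \<not> (a < b \<and> b < c)"
| "avoids _ \<longleftrightarrow> True"

text \<open>Cutting is greedy from the left; on distinct words without 123 it yields the maximal
  increasing runs.\<close>

fun bricks_of :: "nat list \<Rightarrow> nat list list" where
  "bricks_of [] = []"
| "bricks_of [a] = [[a]]"
| "bricks_of (a # b # xs) = (if a < b then [a, b] # bricks_of xs else [a] # bricks_of (b # xs))"

lemma concat_bricks_of: "concat (bricks_of xs) = xs"
  by (induction xs rule: bricks_of.induct) simp_all

lemma brick_bricks_of: "b \<in> set (bricks_of xs) \<Longrightarrow> brick b"
  by (induction xs rule: bricks_of.induct) (auto simp: brick_def split: if_splits)

lemma avoids_Cons:
  "avoids (a # xs) \<longleftrightarrow> avoids xs \<and>
     (\<forall>b c ys. xs = b # c # ys \<longrightarrow> \<not> (a < b \<and> b < c)) \<and>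
     (\<forall>b c d ys. xs = b # c # d # ys \<longrightarrow> \<not> (a < c \<and> c < b \<and> b < d))"
  by (cases "a # xs" rule: avoids.cases) auto

lemma des_singleton: "des [a] = 0"
  by (simp add: des_def)

lemma des_Cons_Cons: "des (a # b # xs) = of_bool (b < a) + des (b # xs)"
proof -
  let ?D = "\<lambda>\<sigma>. {i. Suc i < length \<sigma> \<and> \<sigma> ! i > \<sigma> ! Suc i}"
  have fin: "finite (?D \<sigma>)" for \<sigma> :: "nat list"
    by (rule finite_subset[of _ "{..<length \<sigma>}"]) auto
  have "?D (a # b # xs) = (if b < a then {0} else {}) \<union> Suc ` ?D (b # xs)" (is "?l = ?r")
  proof (rule set_eqI)
    fix i show "i \<in> ?l \<longleftrightarrow> i \<in> ?r" by (cases i) auto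
  qed
  then have "card (?D (a # b # xs)) = of_bool (b < a) + card (?D (b # xs))"
    using fin[of "b # xs"] by (simp add: card_image)
  then show ?thesis by (simp only: des_def)
qed

text \<open>Every boundary between bricks is a descent, since otherwise the left brick would have
  been longer or a 123 would occur; so there is one more brick than descents. The remaining way to
  be linked is a 1324.\<close>

lemma bricks_of_avoids:
  assumes "distinct xs" "avoids xs" "xs \<noteq> []"
  shows "successively (\<lambda>b c. \<not> linked b c) (bricks_of xs) \<and> length (bricks_of xs) = Suc (des xs)"
  using assms
proof (induction xs rule: bricks_of.induct)
  case (3 a b xs)
  show ?case
  proof (cases "a < b")
    case True
    show ?thesis
    proof (cases xs)
      case Nil
      then show ?thesis using True by (simp add: des_Cons_Cons des_singleton)
    next
      case (Cons c ys)
      have "c < b" using 3(3,4) True by (auto simp: Cons avoids_Cons)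
      have "\<not> linked [a, b] (hd (bricks_of xs))"
        using 3(3,4) True \<open>c < b\<close> by (cases ys) (auto simp: Cons linked_def)
      moreover have "avoids xs" using 3(4) by (simp add: avoids_Cons)
      moreover have "bricks_of xs \<noteq> []" using concat_bricks_of[of xs] Cons by auto
      ultimately show ?thesis
        using 3(1)[OF True] 3(3) Cons \<open>c < b\<close> True
        by (simp add: successively_Cons des_Cons_Cons del: bricks_of.simps) (simp add: successively_Cons)
    qed
  next
    case False
    have "\<not> linked [a] (hd (bricks_of (b # xs)))"
      using False by (cases xs) (auto simp: linked_def)
    moreover have "avoids (b # xs)" using 3(4) by (simp add: avoids_Cons)
    ultimately show ?thesis
      using 3(2)[OF False] 3(3) False by (auto simp: successively_Cons des_Cons_Cons)
  qed
qed (simp_all add: des_singleton)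

text \<open>Neighbours that are not linked descend at their boundary, so the greedy cut finds the
  same bricks and no 123 occurs. A 1324 would fill two neighbouring two-letter bricks and link
  them.\<close>

lemma unlinked_chain_concat:
  assumes "\<forall>b\<in>set bs. brick b" "distinct (concat bs)"
    "successively (\<lambda>b c. \<not> linked b c) bs"
  shows "avoids (concat bs) \<and> bricks_of (concat bs) = bs"
  using assms
proof (induction bs rule: induct_list012)
  case (2 b)
  then show ?case by (auto simp: brick_def)
next
  case (3 b c bs)
  have IH: "avoids (concat (c # bs))" "bricks_of (concat (c # bs)) = c # bs"
    using 3(2) 3(3-5) by auto
  have "brick b" "brick c" using 3(3) by simp_all
  have unlinked: "\<not> linked b c" using 3(5) by simp
  obtain z zs where zs: "concat (c # bs) = z # zs" "hd c = z"
    using \<open>brick c\<close> by (auto simp: brick_def)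
  have "distinct (b @ z # zs)" using 3(4) by (simp add: zs(1)[symmetric])
  then have "last b \<noteq> z" using \<open>brick b\<close> by (auto simp: brick_def)
  moreover have "\<not> last b < z"
    using unlinked zs by (simp add: linked_def)
  ultimately have less: "z < last b" by simp
  \<comment> \<open>Both patterns begin with an ascent, so a letter above \<open>z\<close> in front
    of \<open>z\<close> starts neither.\<close>
  have avoids_last: "avoids (last b # z # zs)"
    using IH(1) less unfolding zs(1) by (auto simp: avoids_Cons[of "last b"])
  from \<open>brick b\<close> consider x where "b = [x]" | x y where "b = [x, y]" "x < y"
    by (auto simp: brick_def)
  then show ?case
  proof cases
    case 1
    then show ?thesis using IH(2) less avoids_last zs(1) by simp
  next
    case 2
    \<comment> \<open>If \<open>c\<close> is the single letter \<open>z\<close>, then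
      \<open>d\<close> begins the next brick and \<open>z < d\<close> links \<open>c\<close> to it.
      If \<open>c\<close> is \<open>[z, d]\<close>, then \<open>b\<close> and \<open>c\<close> are
      linked as a 1324.\<close>
    have no_1324: False if d: "x < z" "zs = d # ws" "y < d" for d ws
    proof -
      have "z < y" "z < d" using less d 2 by auto
      from \<open>brick c\<close> consider "c = [z]" | e where "c = [z, e]"
        using zs(2) by (auto simp: brick_def)
      then show False
      proof cases
        case 1
        then obtain c' bs' where bs: "bs = c' # bs'" using zs d by (cases bs) auto
        then have "hd c' = d" using zs d 1 3(3) by (auto simp: brick_def)
        then show False using 3(5) \<open>z < d\<close> by (simp add: bs 1 linked_def)
      next
        case c: 2
        then have "e = d" using zs d by simp
        then show False using unlinked d less by (simp add: c 2 linked_def)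
      qed
    qed
    have "avoids (x # y # z # zs)"
      using avoids_last less no_1324 2 by (auto simp: avoids_Cons[of x])
    then show ?thesis using IH(2) 2 zs(1) by simp
  qed
qed simp

section \<open>Matches as comparisons between letters\<close>

text \<open>The ranks computed by \<open>red\<close> are ordered like the letters, so a value of
  \<open>red\<close> translates into comparisons.\<close>

lemma card_atMost_less_iff:
  fixes x y :: nat
  assumes "x \<in> set \<alpha>" "y \<in> set \<alpha>"
  shows "card {b \<in> set \<alpha>. b \<le> x} < card {b \<in> set \<alpha>. b \<le> y} \<longleftrightarrow> x < y"
proof
  assume "x < y"
  then have "y \<in> {b \<in> set \<alpha>. b \<le> y} - {b \<in> set \<alpha>. b \<le> x}" using assms by simp
  with \<open>x < y\<close> have "{b \<in> set \<alpha>. b \<le> x} \<subset> {b \<in> set \<alpha>. b \<le> y}" by force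
  then show "card {b \<in> set \<alpha>. b \<le> x} < card {b \<in> set \<alpha>. b \<le> y}"
    by (intro psubset_card_mono) auto
next
  assume *: "card {b \<in> set \<alpha>. b \<le> x} < card {b \<in> set \<alpha>. b \<le> y}"
  show "x < y"
  proof (rule ccontr)
    assume "\<not> x < y"
    then have "card {b \<in> set \<alpha>. b \<le> y} \<le> card {b \<in> set \<alpha>. b \<le> x}"
      by (intro card_mono) auto
    then show False using * by simp
  qed
qed

lemma red_eq_123: "red [a, b, c] = [1, 2, 3] \<longleftrightarrow> a < b \<and> b < c"
proof
  assume "red [a, b, c] = [1, 2, 3]"
  then show "a < b \<and> b < c"
    using card_atMost_less_iff[of a "[a, b, c]" b] card_atMost_less_iff[of b "[a, b, c]" c]
    by (simp add: red_def)
next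
  assume "a < b \<and> b < c"
  then have "{x \<in> {a, b, c}. x \<le> a} = {a}" "{x \<in> {a, b, c}. x \<le> b} = {a, b}"
    "{x \<in> {a, b, c}. x \<le> c} = {a, b, c}" by auto
  then show "red [a, b, c] = [1, 2, 3]"
    using \<open>a < b \<and> b < c\<close> by (simp add: red_def)
qed

lemma red_eq_1324: "red [a, b, c, d] = [1, 3, 2, 4] \<longleftrightarrow> a < c \<and> c < b \<and> b < d"
proof
  assume "red [a, b, c, d] = [1, 3, 2, 4]"
  then show "a < c \<and> c < b \<and> b < d"
    using card_atMost_less_iff[of a "[a, b, c, d]" c] card_atMost_less_iff[of c "[a, b, c, d]" b]
      card_atMost_less_iff[of b "[a, b, c, d]" d]
    by (simp add: red_def)
next
  assume "a < c \<and> c < b \<and> b < d"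
  then have "{x \<in> {a, b, c, d}. x \<le> a} = {a}" "{x \<in> {a, b, c, d}. x \<le> c} = {a, c}"
    "{x \<in> {a, b, c, d}. x \<le> b} = {a, c, b}" "{x \<in> {a, b, c, d}. x \<le> d} = {a, c, b, d}" by auto
  then show "red [a, b, c, d] = [1, 3, 2, 4]"
    using \<open>a < c \<and> c < b \<and> b < d\<close> by (simp add: red_def)
qed

lemma match_at_Cons_Suc: "match_at \<Gamma> (a # \<sigma>) (Suc i) \<longleftrightarrow> match_at \<Gamma> \<sigma> i"
proof -
  have "map (\<lambda>l. (a # \<sigma>) ! l) [Suc i..<Suc (Suc i + j)] = map (\<lambda>l. \<sigma> ! l) [i..<Suc (i + j)]" for j
    by (simp add: map_Suc_upt[symmetric] del: upt_Suc map_Suc_upt)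
  then show ?thesis by (simp add: match_at_def del: upt_Suc)
qed

lemma match_at_0_iff:
  "match_at {[1,3,2,4], [1,2,3]} \<sigma> 0 \<longleftrightarrow>
     (\<exists>a b c xs. \<sigma> = a # b # c # xs \<and> a < b \<and> b < c) \<or>
     (\<exists>a b c d xs. \<sigma> = a # b # c # d # xs \<and> a < c \<and> c < b \<and> b < d)"
    (is "_ \<longleftrightarrow> ?P \<or> ?Q")
proof -
  have take: "map (\<lambda>l. \<sigma> ! l) [0..<Suc j] = take (Suc j) \<sigma>" if "j < length \<sigma>" for j
    using that by (intro nth_equalityI) (auto simp del: upt_Suc)
  have "match_at {[1,3,2,4], [1,2,3]} \<sigma> 0 \<longleftrightarrow>
      (\<exists>j\<ge>1. j < length \<sigma> \<and> red (take (Suc j) \<sigma>) \<in> {[1,3,2,4], [1,2,3]})"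
    unfolding match_at_def add_0 using take by (metis (no_types, lifting))
  also have "\<dots> \<longleftrightarrow> ?P \<or> ?Q"
  proof
    assume "\<exists>j\<ge>1. j < length \<sigma> \<and> red (take (Suc j) \<sigma>) \<in> {[1,3,2,4], [1,2,3]}"
    then obtain j where j: "j < length \<sigma>" "red (take (Suc j) \<sigma>) \<in> {[1,3,2,4], [1,2,3]}"
      by blast
    \<comment> \<open>\<open>red\<close> preserves length, so only windows of three or four letters
      can match.\<close>
    have "length (red (take (Suc j) \<sigma>)) = Suc j" using j(1) by (simp add: red_def)
    moreover have "length (red (take (Suc j) \<sigma>)) \<in> {4, 3}" using j(2) by auto
    ultimately have "j = 3 \<or> j = 2" by auto
    then show "?P \<or> ?Q"
    proof
      assume "j = 3"
      then obtain a b c d xs where "\<sigma> = a # b # c # d # xs"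
        using j(1) by (auto simp: numeral_3_eq_3 less_eq_Suc_le Suc_le_length_iff)
      then show ?thesis using j(2) \<open>j = 3\<close> red_eq_1324[of a b c d]
        by (auto simp: red_def)
    next
      assume "j = 2"
      then obtain a b c xs where "\<sigma> = a # b # c # xs"
        using j(1) by (auto simp: numeral_2_eq_2 less_eq_Suc_le Suc_le_length_iff)
      then show ?thesis using j(2) \<open>j = 2\<close> red_eq_123[of a b c]
        by (auto simp: red_def)
    qed
  next
    assume "?P \<or> ?Q"
    then show "\<exists>j\<ge>1. j < length \<sigma> \<and> red (take (Suc j) \<sigma>) \<in> {[1,3,2,4], [1,2,3]}"
    proof
      assume ?P
      then obtain a b c xs where "\<sigma> = a # b # c # xs" "a < b" "b < c" by blast
      then show ?thesis using red_eq_123[of a b c] by (intro exI[of _ 2]) simp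
    next
      assume ?Q
      then obtain a b c d xs where "\<sigma> = a # b # c # d # xs" "a < c" "c < b" "b < d" by blast
      then show ?thesis using red_eq_1324[of a b c d] by (intro exI[of _ 3]) simp
    qed
  qed
  finally show ?thesis .
qed

lemma avoids_iff_no_match:
  "avoids \<sigma> \<longleftrightarrow> \<not> (\<exists>i. match_at {[1,3,2,4], [1,2,3]} \<sigma> i)"
proof (induction \<sigma>)
  case Nil
  show ?case by (simp add: match_at_def)
next
  case (Cons a \<sigma>)
  have "(\<exists>i. match_at \<Gamma> (a # \<sigma>) i) \<longleftrightarrow> match_at \<Gamma> (a # \<sigma>) 0 \<or> (\<exists>i. match_at \<Gamma> \<sigma> i)" for \<Gamma>
    by (metis match_at_Cons_Suc not0_implies_Suc)
  then show ?case using Cons.IH by (auto simp: avoids_Cons[of a] match_at_0_iff simp del: One_nat_def)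
qed

section \<open>The reciprocal of the generating function\<close>

text \<open>\<open>bricks_of\<close> and \<open>concat\<close> are inverse bijections that turn
  \<open>1 + des\<close> into the number of bricks. The empty word is excluded: it has no brick, but
  \<open>1 + des [] = 1\<close>.\<close>

lemma sum_NM_eq_unlinked_poly:
  assumes "n > 0"
  shows "(\<Sum>\<sigma>\<in>NM {[1,3,2,4], [1,2,3]} n. Y ^ (1 + des \<sigma>)) = unlinked_poly {1..n}"
  unfolding unlinked_poly_def
proof (rule sum.reindex_bij_witness[where i = concat and j = bricks_of])
  fix \<sigma> assume "\<sigma> \<in> NM {[1,3,2,4], [1,2,3]} n"
  then have \<sigma>: "set \<sigma> = {1..n}" "distinct \<sigma>" "avoids \<sigma>"
    by (simp_all add: NM_def permutations_of_set_def avoids_iff_no_match)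
  then have "\<sigma> \<noteq> []" using assms by auto
  note * = bricks_of_avoids[OF \<sigma>(2,3) this]
  show "concat (bricks_of \<sigma>) = \<sigma>" by (rule concat_bricks_of)
  show "bricks_of \<sigma> \<in> unlinked_chains {1..n}"
    using * \<sigma> concat_bricks_of[of \<sigma>] brick_bricks_of
    by (simp add: unlinked_chains_def brick_lists_def del: set_concat)
  show "Y ^ length (bricks_of \<sigma>) = Y ^ (1 + des \<sigma>)" using * by simp
next
  fix bs assume "bs \<in> unlinked_chains {1..n}"
  then have bs: "\<forall>b\<in>set bs. brick b" "distinct (concat bs)"
    "successively (\<lambda>b c. \<not> linked b c) bs" "set (concat bs) = {1..n}"
    by (simp_all add: unlinked_chains_def brick_lists_def)
  note * = unlinked_chain_concat[OF bs(1-3)]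
  show "bricks_of (concat bs) = bs" using * by simp
  show "concat bs \<in> NM {[1,3,2,4], [1,2,3]} n"
    using * bs by (simp add: NM_def permutations_of_set_def avoids_iff_no_match del: One_nat_def)
qed

lemma NM_egf_nth:
  "fps_nth (NM_egf {[1,3,2,4], [1,2,3]}) n = smult (1 / fact n) (unlinked_poly {1..n})"
proof (cases n)
  case 0
  then show ?thesis
    by (simp add: NM_egf_def unlinked_poly_def unlinked_chains_empty)
next
  case (Suc m)
  then show ?thesis
    using sum_NM_eq_unlinked_poly[of n] by (simp add: NM_egf_def)
qed

text \<open>By \<open>U_unique\<close> it suffices that the product of the two series is 1. Its
  coefficients are binomial convolutions, which vanish for positive \<open>n\<close> by
  \<open>unlinked_poly_card_Suc\<close>.\<close>

lemma U_eq_ballot_poly: "U {[1,3,2,4], [1,2,3]} = ballot_poly 0"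
proof (rule U_unique[symmetric], rule fps_ext)
  fix n
  let ?G = "Abs_fps (\<lambda>n. smult (1 / fact n) (ballot_poly 0 n))"
  let ?c = "\<lambda>k. of_nat (n choose k) * (unlinked_poly {1..k} * ballot_poly 0 (n - k))"
  have "fps_nth (NM_egf {[1,3,2,4], [1,2,3]} * ?G) n = (\<Sum>k\<le>n. smult (1 / fact n) (?c k))"
    unfolding fps_mult_nth atLeast0AtMost
  proof (rule sum.cong[OF refl])
    fix k assume "k \<in> {..n}"
    then have "1 / (fact k * fact (n - k)) = (1 / fact n * of_nat (n choose k) :: rat)"
      by (simp add: binomial_fact)
    then show "fps_nth (NM_egf {[1,3,2,4], [1,2,3]}) k * fps_nth ?G (n - k) = smult (1 / fact n) (?c k)"
      by (simp add: NM_egf_nth of_nat_poly mult.commute del: One_nat_def)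
  qed
  also have "\<dots> = fps_nth 1 n"
  proof (cases n)
    case 0
    then show ?thesis
      by (simp add: unlinked_poly_def unlinked_chains_empty ballot_poly_def ballot_0)
  next
    case (Suc m)
    \<comment> \<open>The term \<open>k = n\<close> of the convolution is
      \<open>unlinked_poly {1..n}\<close>, because \<open>ballot_poly 0 0 = 1\<close>.\<close>
    have "(\<Sum>k\<le>m. ?c k) + unlinked_poly {1..n} = 0"
    proof -
      have "unlinked_poly T = unlinked_poly {1..card T}" if "T \<subset> {1..n}" for T
        using that finite_subset[of T "{1..n}"] by (intro unlinked_poly_card) auto
      with unlinked_poly_card_Suc[of "{1..n}" m] show ?thesis by (simp add: Suc)
    qed
    then have "(\<Sum>k\<le>n. ?c k) = 0"
      by (simp add: Suc ballot_poly_def[of 0 0] ballot_0)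
    moreover have "(\<Sum>k\<le>n. smult (1 / fact n) (?c k)) = [:1 / fact n:] * (\<Sum>k\<le>n. ?c k)"
      by (simp add: sum_distrib_left)
    ultimately show ?thesis by (simp only: mult_zero_right) (simp add: Suc)
  qed
  finally show "fps_nth (NM_egf {[1,3,2,4], [1,2,3]} * ?G) n = fps_nth 1 n" .
qed

section \<open>Closed form of the coefficients\<close>

lemma ballot_eq:
  assumes "2 * u \<le> m"
  shows "ballot m u = of_nat ((m + 1 - 2 * u) * (m choose u)) / of_nat (m + 1 - u)"
proof (cases u)
  case 0
  then show ?thesis by (simp add: ballot_0 del: of_nat_Suc)
next
  case (Suc v)
  \<comment> \<open>Both sides equal \<open>m * ((m - 1) choose v)\<close>; this brings the
    difference of binomials to the common denominator \<open>m - v\<close>.\<close>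
  have "(m - v) * (m choose v) = u * (m choose u)"
    using binomial_absorb_comp[of m v] binomial_absorption[of v m] by (simp add: Suc)
  then have "of_nat (m - v) * of_nat (m choose v) = (of_nat u * of_nat (m choose u) :: rat)"
    by (simp flip: of_nat_mult)
  then have "ballot m u * of_nat (m - v) = of_nat (m - v) * of_nat (m choose u) - of_nat u * of_nat (m choose u)"
    by (simp add: ballot_def Suc algebra_simps)
  also have "\<dots> = of_nat (m - v - u) * of_nat (m choose u)"
    using assms Suc by (simp add: of_nat_diff algebra_simps)
  also have "m - v - u = m + 1 - 2 * u" using Suc by simp
  finally show ?thesis using assms Suc by (simp add: field_simps)
qed

text \<open>For either parity the range \<open>2 * u \<le> m\<close> is \<open>u \<le> n\<close>,
  and reversing it by \<open>u = n - k\<close> lists the powers of \<open>- Y\<close> in increasing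
  order.\<close>

lemma ballot_poly_0_eq:
  assumes "m = 2 * n \<or> m = 2 * n + 1"
  shows "ballot_poly 0 m =
    (\<Sum>k=0..n. smult (of_nat ((m + 1 - 2 * (n - k)) * (m choose (n - k))) / of_nat (m + 1 - (n - k)))
      ((- Y) ^ (m - (n - k))))"
proof -
  have "ballot_poly 0 m = (\<Sum>u\<in>{0..n}. smult (ballot m u) ((- Y) ^ (m - u)))"
    unfolding ballot_poly_def using assms
    by (intro sum.mono_neutral_cong_right) auto
  also have "\<dots> = (\<Sum>k\<in>{0..n}. smult (ballot m (n - k)) ((- Y) ^ (m - (n - k))))"
    by (rule sum.reindex_bij_witness[where i = "\<lambda>k. n - k" and j = "\<lambda>k. n - k"]) auto
  also have "\<dots> = (\<Sum>k=0..n. smult (of_nat ((m + 1 - 2 * (n - k)) * (m choose (n - k))) / of_nat (m + 1 - (n - k)))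
      ((- Y) ^ (m - (n - k))))"
    using assms by (intro sum.cong refl) (auto simp: ballot_eq)
  finally show ?thesis .
qed

theorem theorem7:
  fixes n :: nat and \<Gamma> :: "nat list set"
  assumes "\<Gamma> = {[1,3,2,4], [1,2,3]}"
  shows "U \<Gamma> (2 * n) =
           (\<Sum>k=0..n. smult (of_nat ((2 * k + 1) * ((2 * n) choose (n - k))) / of_nat (n + k + 1))
                             ((- Y) ^ (n + k)))
       \<and> U \<Gamma> (2 * n + 1) =
           (\<Sum>k=0..n. smult (of_nat (2 * (k + 1) * ((2 * n + 1) choose (n - k))) / of_nat (n + k + 2))
                             ((- Y) ^ (n + k + 1)))"
proof
  \<comment> \<open>These are the coefficients and exponents of \<open>ballot_poly_0_eq\<close> for
    \<open>m = 2 * n\<close>; \<open>k \<le> n\<close> makes the truncated differences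
    exact.\<close>
  have "2 * n + 1 - 2 * (n - k) = 2 * k + 1" "2 * n + 1 - (n - k) = n + k + 1"
    "2 * n - (n - k) = n + k" if "k \<in> {0..n}" for k
    using that by auto
  then show "U \<Gamma> (2 * n) =
      (\<Sum>k=0..n. smult (of_nat ((2 * k + 1) * ((2 * n) choose (n - k))) / of_nat (n + k + 1))
        ((- Y) ^ (n + k)))"
    unfolding assms U_eq_ballot_poly ballot_poly_0_eq[OF disjI1[OF refl]]
    by (intro sum.cong refl) (simp only:)
  have "2 * n + 1 + 1 - 2 * (n - k) = 2 * (k + 1)" "2 * n + 1 + 1 - (n - k) = n + k + 2"
    "2 * n + 1 - (n - k) = n + k + 1" if "k \<in> {0..n}" for k
    using that by auto
  then show "U \<Gamma> (2 * n + 1) =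
      (\<Sum>k=0..n. smult (of_nat (2 * (k + 1) * ((2 * n + 1) choose (n - k))) / of_nat (n + k + 2))
        ((- Y) ^ (n + k + 1)))"
    unfolding assms U_eq_ballot_poly ballot_poly_0_eq[OF disjI2[OF refl]]
    by (intro sum.cong refl) (simp only:)
qed

end
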